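(* Let $G$ be a finite group and let $\mathcal{O}$ be a $G$-transfer system. If the maximal compatible transfer system $\mathrm{M}(\mathcal{O})$ is disklike, then $\mathrm{M}(\mathcal{O})=\mathcal{O}$.
   Context: For a finite group $G$, a $G$-transfer system $\mathcal{O}$ is a binary relation $\to$ on the set of subgroups of $G$, refining inclusion ($K\to H$ implies $K\le H$), such that: $H\to H$ for all $H\le G$; $K\to H$ implies $gKg^{-1}\to gHg^{-1}$ for all $g\in G$; $K\to H$ and $L\le H$ imply $K\cap L\to L$; and $L\to K$, $K\to H$ imply $L\to H$. Its elements are called transfers. $\mathcal{O}$ is disklike if it is generated by transfers with target $G$, i.e. it is the smallest $G$-transfer system containing some set of pairs of the form $H\to G$ (equivalently, every transfer of $\mathcal{O}$ is $H\cap L\to L$ for some $H\to G$ in $\mathcal{O}$ and $L\le G$). A pair $(\mathcal{O}_a,\mathcal{O}_m)$ of $G$-transfer systems is compatible if $\mathcal{O}_m\subseteq\mathcal{O}_a$ and, for all $K,J\le H\le G$, if $K\to H$ is in $\mathcal{O}_m$ and $K\cap J\to K$ is in $\mathcal{O}_a$, then $J\to H$ is in $\mathcal{O}_a$. $\mathrm{M}(\mathcal{O})$ denotes the unique largest (under containment) $G$-transfer system such that $(\mathcal{O},\mathrm{M}(\mathcal{O}))$ is compatible. *)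

theory Defs
  imports "HOL-Algebra.Coset"
begin

definition transfer_system :: "('a, 'b) monoid_scheme \<Rightarrow> 'a set rel \<Rightarrow> bool" where
  "transfer_system G T \<longleftrightarrow>
     (\<forall>K H. (K, H) \<in> T \<longrightarrow> subgroup K G \<and> subgroup H G \<and> K \<subseteq> H) \<and>
     (\<forall>H. subgroup H G \<longrightarrow> (H, H) \<in> T) \<and>
     (\<forall>K H. \<forall>g \<in> carrier G. (K, H) \<in> T \<longrightarrow>
        (g <#\<^bsub>G\<^esub> K #>\<^bsub>G\<^esub> inv\<^bsub>G\<^esub> g, g <#\<^bsub>G\<^esub> H #>\<^bsub>G\<^esub> inv\<^bsub>G\<^esub> g) \<in> T) \<and>
     (\<forall>K H L. (K, H) \<in> T \<and> subgroup L G \<and> L \<subseteq> H \<longrightarrow> (K \<inter> L, L) \<in> T) \<and>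
     (\<forall>L K H. (L, K) \<in> T \<and> (K, H) \<in> T \<longrightarrow> (L, H) \<in> T)"

text \<open>The intersection is over a nonempty family, and hence a transfer system, as soon as
  \<open>S\<close> consists of inclusions of subgroups of \<open>G\<close>.\<close>

definition generated_transfer_system ::
    "('a, 'b) monoid_scheme \<Rightarrow> 'a set rel \<Rightarrow> 'a set rel" where
  "generated_transfer_system G S = \<Inter> {T. transfer_system G T \<and> S \<subseteq> T}"

definition disklike :: "('a, 'b) monoid_scheme \<Rightarrow> 'a set rel \<Rightarrow> bool" where
  "disklike G T \<longleftrightarrow>
     (\<exists>S. S \<subseteq> {(H, carrier G) | H. subgroup H G} \<and> T = generated_transfer_system G S)"

definition compatible :: "('a, 'b) monoid_scheme \<Rightarrow> 'a set rel \<Rightarrow> 'a set rel \<Rightarrow> bool" where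
  "compatible G A M \<longleftrightarrow>
     transfer_system G A \<and> transfer_system G M \<and> M \<subseteq> A \<and>
     (\<forall>H K J. subgroup H G \<and> subgroup K G \<and> subgroup J G \<and> K \<subseteq> H \<and> J \<subseteq> H \<and>
        (K, H) \<in> M \<and> (K \<inter> J, K) \<in> A \<longrightarrow> (J, H) \<in> A)"

text \<open>The order on relations is containment, so this is the largest system, not merely a
  maximal one. It exists whenever \<open>T\<close> is a transfer system, by
  \<open>maximal_compatible_is_greatest\<close> below.\<close>

definition maximal_compatible :: "('a, 'b) monoid_scheme \<Rightarrow> 'a set rel \<Rightarrow> 'a set rel" where
  "maximal_compatible G T = (GREATEST M. compatible G T M)"

lemma transfer_systemD:
  assumes "transfer_system G T"
  shows "(K, H) \<in> T \<Longrightarrow> subgroup K G" "(K, H) \<in> T \<Longrightarrow> subgroup H G" "(K, H) \<in> T \<Longrightarrow> K \<subseteq> H"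
    and "subgroup H G \<Longrightarrow> (H, H) \<in> T"
    and "(K, H) \<in> T \<Longrightarrow> g \<in> carrier G \<Longrightarrow>
      (g <#\<^bsub>G\<^esub> K #>\<^bsub>G\<^esub> inv\<^bsub>G\<^esub> g, g <#\<^bsub>G\<^esub> H #>\<^bsub>G\<^esub> inv\<^bsub>G\<^esub> g) \<in> T"
    and "(K, H) \<in> T \<Longrightarrow> subgroup L G \<Longrightarrow> L \<subseteq> H \<Longrightarrow> (K \<inter> L, L) \<in> T"
    and "(L, K) \<in> T \<Longrightarrow> (K, H) \<in> T \<Longrightarrow> (L, H) \<in> T"
proof -
  note T = assms[unfolded transfer_system_def]
  show "(K, H) \<in> T \<Longrightarrow> subgroup K G" "(K, H) \<in> T \<Longrightarrow> subgroup H G" "(K, H) \<in> T \<Longrightarrow> K \<subseteq> H"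
    using T[THEN conjunct1] by blast+
  show "subgroup H G \<Longrightarrow> (H, H) \<in> T"
    using T[THEN conjunct2, THEN conjunct1] by blast
  show "(K, H) \<in> T \<Longrightarrow> g \<in> carrier G \<Longrightarrow>
      (g <#\<^bsub>G\<^esub> K #>\<^bsub>G\<^esub> inv\<^bsub>G\<^esub> g, g <#\<^bsub>G\<^esub> H #>\<^bsub>G\<^esub> inv\<^bsub>G\<^esub> g) \<in> T"
    using T[THEN conjunct2, THEN conjunct2, THEN conjunct1] by blast
  show "(K, H) \<in> T \<Longrightarrow> subgroup L G \<Longrightarrow> L \<subseteq> H \<Longrightarrow> (K \<inter> L, L) \<in> T"
    using T[THEN conjunct2, THEN conjunct2, THEN conjunct2, THEN conjunct1] by blast
  show "(L, K) \<in> T \<Longrightarrow> (K, H) \<in> T \<Longrightarrow> (L, H) \<in> T"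
    using T[THEN conjunct2, THEN conjunct2, THEN conjunct2, THEN conjunct2] by blast
qed

lemma compatibleD:
  assumes "compatible G A M"
  shows "transfer_system G A" "transfer_system G M" "M \<subseteq> A"
    and "(K, H) \<in> M \<Longrightarrow> subgroup J G \<Longrightarrow> J \<subseteq> H \<Longrightarrow> (K \<inter> J, K) \<in> A \<Longrightarrow> (J, H) \<in> A"
proof -
  show M: "transfer_system G A" "transfer_system G M" "M \<subseteq> A"
    using assms by (simp_all add: compatible_def)
  show "(J, H) \<in> A" if "(K, H) \<in> M" "subgroup J G" "J \<subseteq> H" "(K \<inter> J, K) \<in> A"
    using assms[unfolded compatible_def] that transfer_systemD(1-3)[OF M(2) that(1)] by blast
qed

lemma compatible_identity:
  assumes "group G" and T: "transfer_system G T"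
  shows "compatible G T {(H, H) | H. subgroup H G}"
proof -
  interpret group G by fact
  have "subgroup (g <#\<^bsub>G\<^esub> H #>\<^bsub>G\<^esub> inv\<^bsub>G\<^esub> g) G" if "g \<in> carrier G" "subgroup H G" for g H
  proof -
    have "(H, H) \<in> T" using T that(2) by (rule transfer_systemD)
    then have "(g <#\<^bsub>G\<^esub> H #>\<^bsub>G\<^esub> inv\<^bsub>G\<^esub> g, g <#\<^bsub>G\<^esub> H #>\<^bsub>G\<^esub> inv\<^bsub>G\<^esub> g) \<in> T"
      by (rule transfer_systemD(5)[OF T _ that(1)])
    then show ?thesis by (rule transfer_systemD(1)[OF T])
  qed
  then have "transfer_system G {(H, H) | H. subgroup H G}"
    by (auto simp: transfer_system_def Int_absorb1)
  moreover have "{(H, H) | H. subgroup H G} \<subseteq> T"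
    using transfer_systemD(4)[OF T] by auto
  ultimately show ?thesis
    unfolding compatible_def using T by (auto simp: Int_absorb1)
qed

lemma compatible_join:
  assumes "group G" and T: "transfer_system G T"
  shows "compatible G T ((\<Union> {M. compatible G T M})\<^sup>+)"
proof -
  let ?U = "\<Union> {M. compatible G T M}"
  let ?c = "\<lambda>g H. g <#\<^bsub>G\<^esub> H #>\<^bsub>G\<^esub> inv\<^bsub>G\<^esub> g"
  have Umem: "(K, H) \<in> ?U" if "compatible G T M" "(K, H) \<in> M" for M K H
    using that by blast
  have Uobt: "\<exists>M. compatible G T M \<and> (K, H) \<in> M" if "(K, H) \<in> ?U" for K H
    using that by blast
  have U: "subgroup K G \<and> subgroup H G \<and> K \<subseteq> H \<and> (K, H) \<in> T" if KH: "(K, H) \<in> ?U" for K H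
  proof -
    obtain M where M: "compatible G T M" "(K, H) \<in> M" using Uobt[OF KH] by blast
    show ?thesis
      using transfer_systemD(1-3)[OF compatibleD(2)[OF M(1)] M(2)] compatibleD(3)[OF M(1)] M(2)
      by blast
  qed
  have Uconj: "(?c g K, ?c g H) \<in> ?U" if KH: "(K, H) \<in> ?U" and g: "g \<in> carrier G" for g K H
  proof -
    obtain M where M: "compatible G T M" "(K, H) \<in> M" using Uobt[OF KH] by blast
    show ?thesis
      by (rule Umem[OF M(1) transfer_systemD(5)[OF compatibleD(2)[OF M(1)] M(2) g]])
  qed
  have Ures: "(K \<inter> L, L) \<in> ?U" if KH: "(K, H) \<in> ?U" and L: "subgroup L G" "L \<subseteq> H" for K H L
  proof -
    obtain M where M: "compatible G T M" "(K, H) \<in> M" using Uobt[OF KH] by blast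
    show ?thesis
      by (rule Umem[OF M(1) transfer_systemD(6)[OF compatibleD(2)[OF M(1)] M(2) L]])
  qed
  have Ucomp: "(J, H) \<in> T"
    if KH: "(K, H) \<in> ?U" and J: "subgroup J G" "J \<subseteq> H" "(K \<inter> J, K) \<in> T" for J K H
  proof -
    obtain M where M: "compatible G T M" "(K, H) \<in> M" using Uobt[OF KH] by blast
    show ?thesis by (rule compatibleD(4)[OF M J])
  qed
  have Trans: "(L, H) \<in> T" if "(L, K) \<in> T" "(K, H) \<in> T" for L K H
    using T that by (rule transfer_systemD)
  have P: "subgroup K G \<and> subgroup H G \<and> K \<subseteq> H \<and> (K, H) \<in> T" if "(K, H) \<in> ?U\<^sup>+" for K H
    using that
  proof induction
    case (base H) then show ?case by (rule U)
  next
    case (step L H) then show ?case using U[OF step.hyps(2)] Trans by blast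
  qed
  have Pconj: "(?c g K, ?c g H) \<in> ?U\<^sup>+" if "(K, H) \<in> ?U\<^sup>+" "g \<in> carrier G" for g K H
    using that
  proof induction
    case (base H) then show ?case using Uconj by (blast intro: r_into_trancl)
  next
    case (step L H)
    show ?case
      by (rule trancl_into_trancl[OF step.IH[OF step.prems] Uconj[OF step.hyps(2) step.prems]])
  qed
  have Pres: "(K \<inter> L, L) \<in> ?U\<^sup>+" if "(K, H) \<in> ?U\<^sup>+" "subgroup L G" "L \<subseteq> H" for K H L
    using that
  proof (induction arbitrary: L)
    case (base H) show ?case by (rule r_into_trancl, rule Ures[OF base])
  next
    case (step H H')
    have 1: "(H \<inter> L, L) \<in> ?U" by (rule Ures[OF step.hyps(2) step.prems])
    have "(K \<inter> (H \<inter> L), H \<inter> L) \<in> ?U\<^sup>+" using step.IH[of "H \<inter> L"] U[OF 1] by blast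
    moreover have "K \<inter> (H \<inter> L) = K \<inter> L" using P[OF step.hyps(1)] by blast
    ultimately show ?case using trancl_into_trancl[OF _ 1] by simp
  qed
  have Pcomp: "(J, H) \<in> T"
    if "(K, H) \<in> ?U\<^sup>+" "subgroup J G" "J \<subseteq> H" "(K \<inter> J, K) \<in> T" for J K H
    using that
  proof (induction arbitrary: J)
    case (base H) show ?case by (rule Ucomp[OF base])
  next
    case (step L H)
    have LJ: "(L \<inter> J, J) \<in> ?U" by (rule Ures[OF step.hyps(2) step.prems(1,2)])
    have "K \<inter> (L \<inter> J) = K \<inter> J" using P[OF step.hyps(1)] by blast
    then have "(L \<inter> J, L) \<in> T"
      using step.IH[of "L \<inter> J"] U[OF LJ] step.prems by simp
    then show ?case by (rule Ucomp[OF step.hyps(2) step.prems(1,2)])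
  qed
  have "(H, H) \<in> ?U" if "subgroup H G" for H
    by (rule Umem[OF compatible_identity[OF assms]]) (use that in blast)
  then have "transfer_system G (?U\<^sup>+)"
    unfolding transfer_system_def by (intro conjI allI impI ballI; (elim conjE)?)
      (rule P[THEN conjunct1] P[THEN conjunct2, THEN conjunct1]
        P[THEN conjunct2, THEN conjunct2, THEN conjunct1] Pconj Pres trancl_trans r_into_trancl;
        assumption)+
  then show ?thesis
    by (intro compatible_def[THEN iffD2] conjI allI impI subrelI; (elim conjE)?)
      (use T P Pcomp in blast)+
qed

lemma maximal_compatible_is_greatest:
  assumes "group G" and "transfer_system G T"
  shows "compatible G T (maximal_compatible G T)"
    and "compatible G T M \<Longrightarrow> M \<subseteq> maximal_compatible G T"
proof -
  let ?J = "(\<Union> {M. compatible G T M})\<^sup>+"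
  have ub: "M \<subseteq> ?J" if "compatible G T M" for M
    using that by auto
  have eq: "maximal_compatible G T = ?J"
    unfolding maximal_compatible_def
    by (rule Greatest_equality) (fact compatible_join[OF assms], fact ub)
  show "compatible G T (maximal_compatible G T)"
    unfolding eq by (fact compatible_join[OF assms])
  show "M \<subseteq> maximal_compatible G T" if "compatible G T M"
    unfolding eq by (fact ub[OF that])
qed

end

theory Submission
  imports Defs
begin

text \<open>Write \<open>M\<close> for the maximal compatible system of \<open>T\<close>. Since \<open>M \<subseteq> T\<close>, the task is to place
  every transfer of \<open>T\<close> in \<open>M\<close>, and maximality of \<open>M\<close> reduces this to exhibiting transfer systems
  compatible with \<open>T\<close>. The systems used are the truncations of \<open>T\<close>, which keep only the transfers
  whose target has order at most \<open>n\<close> (together with the identities). They exhaust \<open>T\<close>, because \<open>G\<close> is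
  finite, so it is enough to show by induction on \<open>n\<close> that each one is compatible with \<open>T\<close>.

  So let \<open>K \<rightarrow> H\<close> and \<open>K \<inter> J \<rightarrow> K\<close> be in \<open>T\<close> with \<open>J\<close> properly contained in \<open>H\<close>; the goal is
  \<open>J \<rightarrow> H\<close> in \<open>T\<close>. The restriction \<open>K \<inter> J \<rightarrow> J\<close> has a smaller target than \<open>H\<close>, so by induction it
  lies in \<open>M\<close>. Now disklikeness enters: \<open>K \<inter> J = D \<inter> J\<close> for some \<open>D \<rightarrow> G\<close> in \<open>M\<close>, and therefore
  \<open>D \<inter> H \<rightarrow> H\<close> is in \<open>M\<close>. If \<open>H \<subseteq> D\<close>, then \<open>J = K \<inter> J\<close> and \<open>J \<rightarrow> K \<rightarrow> H\<close> is a composite in \<open>T\<close>.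
  Otherwise \<open>D \<inter> H\<close> is smaller than \<open>H\<close>, so by induction the restriction \<open>K \<inter> D \<rightarrow> D \<inter> H\<close> of
  \<open>K \<rightarrow> H\<close> lies in \<open>M\<close>, and hence so does \<open>K \<inter> D \<rightarrow> H\<close>. Compatibility of \<open>M\<close>, applied to this
  transfer and to \<open>J\<close>, gives \<open>J \<rightarrow> H\<close>; its hypothesis \<open>(K \<inter> D) \<inter> J \<rightarrow> K \<inter> D\<close> is the restriction
  of \<open>K \<inter> J \<rightarrow> K\<close> to \<open>K \<inter> D\<close>, since \<open>K \<inter> J \<subseteq> D\<close>.\<close>

lemma (in group) conjugate_eq_image:
  "g <# H #> inv g = (\<lambda>x. g \<otimes> x \<otimes> inv g) ` H"
  by (auto simp: l_coset_def r_coset_def)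

lemma (in group) inj_on_conjugation:
  assumes "g \<in> carrier G"
  shows "inj_on (\<lambda>x. g \<otimes> x \<otimes> inv g) (carrier G)"
  using assms by (auto simp: inj_on_def)

lemma (in group) conjugate_Int:
  assumes "g \<in> carrier G" "A \<subseteq> carrier G" "B \<subseteq> carrier G"
  shows "g <# (A \<inter> B) #> inv g = (g <# A #> inv g) \<inter> (g <# B #> inv g)"
  unfolding conjugate_eq_image
  by (rule inj_on_image_Int[OF inj_on_conjugation[OF assms(1)] assms(2,3)])

lemma (in group) card_conjugate:
  assumes "g \<in> carrier G" "A \<subseteq> carrier G"
  shows "card (g <# A #> inv g) = card A"
  unfolding conjugate_eq_image
  by (rule card_image[OF inj_on_subset[OF inj_on_conjugation[OF assms(1)] assms(2)]])

lemma (in group) conjugate_carrier: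
  assumes g: "g \<in> carrier G"
  shows "g <# carrier G #> inv g = carrier G"
proof -
  have "x \<in> (\<lambda>x. g \<otimes> x \<otimes> inv g) ` carrier G" if x: "x \<in> carrier G" for x
  proof (rule image_eqI)
    show "x = g \<otimes> (inv g \<otimes> x \<otimes> g) \<otimes> inv g"
      using g x by (metis inv_closed inv_solve_right m_assoc m_closed r_inv l_one)
  qed (use g x in simp)
  then show ?thesis
    using g by (auto simp: conjugate_eq_image)
qed

text \<open>The restrictions of the transfers with target \<open>G\<close> already form a transfer system. The point
  to check is transitivity, and it holds because \<open>D \<rightarrow> G\<close> and \<open>E \<rightarrow> G\<close> imply \<open>D \<inter> E \<rightarrow> E \<rightarrow> G\<close>.\<close>

lemma transfer_system_restrictions:
  assumes "group G" and M: "transfer_system G M"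
  shows "transfer_system G {(D \<inter> L, L) | D L. (D, carrier G) \<in> M \<and> subgroup L G}"
proof -
  interpret group G by fact
  define R where "R = {(D \<inter> L, L) | D L. (D, carrier G) \<in> M \<and> subgroup L G}"
  have RI: "(K, L) \<in> R" if "(D, carrier G) \<in> M" "subgroup L G" "K = D \<inter> L" for D K L
    using that unfolding R_def by blast
  have RE: "\<exists>D. (D, carrier G) \<in> M \<and> subgroup L G \<and> K = D \<inter> L" if "(K, L) \<in> R" for K L
    using that unfolding R_def by blast
  let ?c = "\<lambda>g H. g <#\<^bsub>G\<^esub> H #>\<^bsub>G\<^esub> inv\<^bsub>G\<^esub> g"
  have inM: "(D \<inter> L, L) \<in> M" if "(D, carrier G) \<in> M" "subgroup L G" for D L
    using transfer_systemD(6)[OF M that] subgroup.subset[OF that(2)] by blast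
  have Rsub: "subgroup K G \<and> subgroup H G \<and> K \<subseteq> H" if KH: "(K, H) \<in> R" for K H
  proof -
    have "(K, H) \<in> M" using RE[OF KH] inM by blast
    then show ?thesis using transfer_systemD(1-3)[OF M] by blast
  qed
  have Rrefl: "(H, H) \<in> R" if H: "subgroup H G" for H
  proof (rule RI[OF _ H])
    show "(carrier G, carrier G) \<in> M"
      using transfer_systemD(4)[OF M subgroup_self] .
    show "H = carrier G \<inter> H"
      using subgroup.subset[OF H] by blast
  qed
  have Rconj: "(?c g K, ?c g H) \<in> R" if KH: "(K, H) \<in> R" and g: "g \<in> carrier G" for g K H
  proof -
    obtain D where D: "(D, carrier G) \<in> M" "subgroup H G" "K = D \<inter> H"
      using RE[OF KH] by blast
    show ?thesis
    proof (rule RI)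
      show "(?c g D, carrier G) \<in> M"
        using transfer_systemD(5)[OF M D(1) g] conjugate_carrier[OF g] by simp
      show "subgroup (?c g H) G"
        using transfer_systemD(2)[OF M transfer_systemD(5)[OF M inM[OF D(1,2)] g]] .
      show "?c g K = ?c g D \<inter> ?c g H"
        using conjugate_Int[OF g transfer_systemD(3)[OF M D(1)] subgroup.subset[OF D(2)]] D(3)
        by simp
    qed
  qed
  have Rres: "(K \<inter> L, L) \<in> R" if KH: "(K, H) \<in> R" and L: "subgroup L G" "L \<subseteq> H" for K H L
  proof -
    obtain D where D: "(D, carrier G) \<in> M" "K = D \<inter> H"
      using RE[OF KH] by blast
    have "K \<inter> L = D \<inter> L" using D(2) L(2) by blast
    then show ?thesis by (rule RI[OF D(1) L(1)])
  qed
  have Rtrans: "(L, H) \<in> R" if LK: "(L, K) \<in> R" and KH: "(K, H) \<in> R" for L K H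
  proof -
    obtain D where D: "(D, carrier G) \<in> M" "L = D \<inter> K"
      using RE[OF LK] by blast
    obtain E where E: "(E, carrier G) \<in> M" "subgroup H G" "K = E \<inter> H"
      using RE[OF KH] by blast
    have DE: "(D \<inter> E, carrier G) \<in> M"
      using transfer_systemD(7)[OF M inM[OF D(1) transfer_systemD(1)[OF M E(1)]] E(1)] .
    have "L = (D \<inter> E) \<inter> H" using D(2) E(3) by blast
    then show ?thesis by (rule RI[OF DE E(2)])
  qed
  have "transfer_system G R"
    unfolding transfer_system_def
    by (intro conjI allI impI ballI; (elim conjE)?)
      (rule Rsub[THEN conjunct1] Rsub[THEN conjunct2, THEN conjunct1]
        Rsub[THEN conjunct2, THEN conjunct2] Rrefl Rconj Rres Rtrans; assumption)+
  then show ?thesis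
    unfolding R_def .
qed

text \<open>Minimality of the generated system turns the definition by generators into an explicit
  form of each transfer.\<close>

lemma disklike_transferE:
  assumes "group G" and M: "transfer_system G M" and "disklike G M" and KL: "(K, L) \<in> M"
  obtains D where "(D, carrier G) \<in> M" "K = D \<inter> L"
proof -
  let ?R = "{(D \<inter> L, L) | D L. (D, carrier G) \<in> M \<and> subgroup L G}"
  obtain S where S: "S \<subseteq> {(H, carrier G) | H. subgroup H G}"
    and MS: "M = generated_transfer_system G S"
    using assms(3) unfolding disklike_def by blast
  have "S \<subseteq> M"
    unfolding MS generated_transfer_system_def by blast
  have "S \<subseteq> ?R"
  proof
    fix p assume "p \<in> S"
    then obtain H where H: "p = (H, carrier G)" "subgroup H G" "(H, carrier G) \<in> M"
      using S \<open>S \<subseteq> M\<close> by blast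
    have "p = (H \<inter> carrier G, carrier G)"
      using H(1) subgroup.subset[OF H(2)] by blast
    then show "p \<in> ?R"
      using H(3) group.subgroup_self[OF assms(1)] by blast
  qed
  then have "M \<subseteq> ?R"
    using transfer_system_restrictions[OF assms(1) M]
    unfolding MS generated_transfer_system_def by blast
  then show thesis using KL that by blast
qed

definition truncated_transfers :: "nat \<Rightarrow> 'a set rel \<Rightarrow> 'a set rel" where
  "truncated_transfers n T = {(K, H) \<in> T. K = H \<or> card H \<le> n}"

lemma transfer_system_truncated:
  assumes "group G" and fin: "finite (carrier G)" and T: "transfer_system G T"
  shows "transfer_system G (truncated_transfers n T)"
proof -
  interpret group G by fact
  have mono: "card K \<le> card H" if "K \<subseteq> H" "subgroup H G" for K H
    using that fin by (meson card_mono finite_subset subgroup.subset)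
  have card_conj: "card (g <#\<^bsub>G\<^esub> H #>\<^bsub>G\<^esub> inv\<^bsub>G\<^esub> g) = card H" if "g \<in> carrier G" "(K, H) \<in> T" for g K H
    using card_conjugate that transfer_systemD(2)[OF T] subgroup.subset by blast
  show ?thesis
    unfolding transfer_system_def truncated_transfers_def
  proof (intro conjI allI impI ballI; (elim conjE)?)
    fix K H L
    assume KH: "(K, H) \<in> {(K, H) \<in> T. K = H \<or> card H \<le> n}"
      and L: "subgroup L G" "L \<subseteq> H"
    have "card L \<le> card H"
      using mono L(2) transfer_systemD(2)[OF T] KH by blast
    then show "(K \<inter> L, L) \<in> {(K, H) \<in> T. K = H \<or> card H \<le> n}"
      using KH L transfer_systemD(6)[OF T] by auto
  next
    fix L K H
    assume LK: "(L, K) \<in> {(K, H) \<in> T. K = H \<or> card H \<le> n}"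
      and KH: "(K, H) \<in> {(K, H) \<in> T. K = H \<or> card H \<le> n}"
    then show "(L, H) \<in> {(K, H) \<in> T. K = H \<or> card H \<le> n}"
      using transfer_systemD(7)[OF T] by auto
  qed (use transfer_systemD(1-5)[OF T] card_conj in auto)
qed

text \<open>The induction step. Disklikeness is what lets a transfer of \<open>M\<close> with small target \<open>J\<close> be
  extended to one with target \<open>H\<close>; without it, knowledge about targets smaller than \<open>H\<close> would say
  nothing about \<open>H\<close> itself.\<close>

lemma compatible_condition_if_smaller_targets:
  assumes "group G" and comp: "compatible G T M" and "disklike G M"
    and smaller: "\<And>L L'. (L, L') \<in> T \<Longrightarrow> L' \<subset> H \<Longrightarrow> (L, L') \<in> M"
    and KH: "(K, H) \<in> T" and J: "subgroup J G" "J \<subseteq> H" and KJ: "(K \<inter> J, K) \<in> T"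
  shows "(J, H) \<in> T"
proof (cases "J = H")
  case True
  then show ?thesis using transfer_systemD(4)[OF compatibleD(1)[OF comp] J(1)] by simp
next
  case False
  note T = compatibleD(1)[OF comp] and M = compatibleD(2)[OF comp]
  have "(K \<inter> J, J) \<in> M"
    using smaller transfer_systemD(6)[OF T KH J] False J(2) by blast
  then obtain D where D: "(D, carrier G) \<in> M" and KJD: "K \<inter> J = D \<inter> J"
    using disklike_transferE[OF assms(1) M assms(3)] by blast
  have H: "subgroup H G" using transfer_systemD(2)[OF T KH] .
  have DH: "(D \<inter> H, H) \<in> M"
    using transfer_systemD(6)[OF M D H subgroup.subset[OF H]] .
  show ?thesis
  proof (cases "H \<subseteq> D")
    case True
    then have "K \<inter> J = J" using KJD J(2) by blast
    then show ?thesis using transfer_systemD(7)[OF T KJ KH] by simp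
  next
    case False
    have eq: "K \<inter> (D \<inter> H) = K \<inter> D"
      using transfer_systemD(3)[OF T KH] by blast
    have "(K \<inter> D, D \<inter> H) \<in> T"
      using transfer_systemD(6)[OF T KH transfer_systemD(1)[OF M DH]] eq by auto
    then have "(K \<inter> D, D \<inter> H) \<in> M"
      using smaller False by blast
    then have KDH: "(K \<inter> D, H) \<in> M"
      using transfer_systemD(7)[OF M _ DH] by blast
    have "(K \<inter> J \<inter> (K \<inter> D), K \<inter> D) \<in> T"
      using transfer_systemD(6)[OF T KJ transfer_systemD(1)[OF M KDH]] by blast
    moreover have "K \<inter> J \<inter> (K \<inter> D) = K \<inter> D \<inter> J"
      by blast
    ultimately show ?thesis
      using compatibleD(4)[OF comp KDH J] by simp
  qed
qed

text \<open>The bound \<open>n\<close> is on the order of the target rather than on the target itself, so that the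
  truncation is closed under conjugation and maximality can be applied to it.\<close>

lemma truncated_subset_maximal_compatible:
  assumes "group G" and fin: "finite (carrier G)" and T: "transfer_system G T"
    and disk: "disklike G (maximal_compatible G T)"
  shows "truncated_transfers n T \<subseteq> maximal_compatible G T"
proof (induction n rule: less_induct)
  case (less n)
  let ?M = "maximal_compatible G T"
  have "(J, H) \<in> T"
    if KH: "(K, H) \<in> truncated_transfers n T"
      and J: "subgroup J G" "J \<subseteq> H" and KJ: "(K \<inter> J, K) \<in> T" for K H J
  proof (cases "K = H")
    case True
    then show ?thesis using KJ J(2) by (simp add: Int_absorb1)
  next
    case False
    have KHT: "(K, H) \<in> T" and n: "card H \<le> n"
      using KH False by (auto simp: truncated_transfers_def)
    have finH: "finite H"
      using fin transfer_systemD(2)[OF T KHT] by (meson finite_subset subgroup.subset)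
    have "(L, L') \<in> ?M" if "(L, L') \<in> T" "L' \<subset> H" for L L'
    proof -
      have "card L' < n"
        using psubset_card_mono[OF finH that(2)] n by simp
      moreover have "(L, L') \<in> truncated_transfers (card L') T"
        using that(1) by (simp add: truncated_transfers_def)
      ultimately show ?thesis using less.IH by blast
    qed
    then show ?thesis
      using compatible_condition_if_smaller_targets[OF assms(1)
          maximal_compatible_is_greatest(1)[OF assms(1) T] disk _ KHT J KJ] by blast
  qed
  moreover have "truncated_transfers n T \<subseteq> T"
    by (auto simp: truncated_transfers_def)
  ultimately have "compatible G T (truncated_transfers n T)"
    unfolding compatible_def
    using T transfer_system_truncated[OF assms(1) fin T] by blast
  then show ?case
    by (rule maximal_compatible_is_greatest(2)[OF assms(1) T])
qed

theorem proposition3p14: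
  fixes G :: "('a, 'b) monoid_scheme" and T :: "'a set rel"
  assumes "group G" and "finite (carrier G)"
    and "transfer_system G T"
    and "disklike G (maximal_compatible G T)"
  shows "maximal_compatible G T = T"
proof
  show "maximal_compatible G T \<subseteq> T"
    using compatibleD(3)[OF maximal_compatible_is_greatest(1)[OF assms(1,3)]] .
  show "T \<subseteq> maximal_compatible G T"
  proof (rule subrelI)
    fix K H
    assume "(K, H) \<in> T"
    then have "(K, H) \<in> truncated_transfers (card H) T"
      by (simp add: truncated_transfers_def)
    then show "(K, H) \<in> maximal_compatible G T"
      using truncated_subset_maximal_compatible[OF assms] by blast
  qed
qed

end
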